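(* For every graph $G$, $$2\,\mathrm{lrw}(G)\le \mathrm{lsfw}(G)\le 2^{\mathrm{lrw}(G)+1}.$$ In particular, $\mathrm{lrw}(G)\le 1$ implies $\mathrm{lsfw}(G)\le 4$, and $\mathrm{lrw}(G)\le 2$ implies $\mathrm{lsfw}(G)\le 8$.
   Context: All graphs are finite, simple and undirected. Both parameters are assigned value $0$ on the empty graph. Linear rank-width. For $X\subseteq V(G)$ the cutrank $\rho_G(X)$ is the rank over $\mathbb F_2$ of the $X\times (V(G)\setminus X)$ adjacency matrix. For a linear order $\pi=(v_1,\dots,v_n)$ of $V(G)$ put $P_i=\{v_1,\dots,v_i\}$ for $0\le i\le n$. Then $\mathrm{lrw}(G)=\min_\pi\max_i\rho_G(P_i)$, the minimum over all linear orders $\pi$ of $V(G)$. Sequential cable plays. A configuration on $G$ consists of the set of born vertices, a family $\mathcal L$ of pairwise disjoint nonempty sets of born vertices (the live cables), and a set of already placed edges; initially all are empty. With $\ell=|\mathcal L|$ the number of live cables before a move, the moves are: (i) birth$(S)$: introduces a nonempty set $S$ of fresh (not yet born) vertices of $G$ as one live cable; cost $2\ell+1$. (ii) fold$(X,Y)$: replaces two distinct live cables $X,Y$ by $X\cup Y$; cost $2\ell-1$. (iii) block$(X,Y)$: places every edge between two distinct live cables $X,Y$; legal when all these pairs are edges of $G$ and at least one has not already been placed; cost $2\ell$. (iv) clique$(X)$: places every edge inside a live cable $X$; legal when $X$ is a clique of $G$ and at least one internal edge has not already been placed; cost $2\ell$. (v) close$(X)$: removes the live cable $X$; legal when every edge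 of $G$ incident with a vertex of $X$ has already been placed; cost $2\ell-1$. A play (a finite sequence of legal moves from the initial configuration) constructs $G$ if every vertex is born, every edge of $G$ is placed, and every cable is closed. The width of a play is the maximum cost of its moves, and $\mathrm{lsfw}(G)$ is the minimum width of a play constructing $G$. *)

theory Defs
  imports
    "Graph_Theory.Pair_Digraph"
    "HOL-Combinatorics.Multiset_Permutations"
    "HOL-Library.Function_Algebras"
    "HOL-Library.Z2"
begin

text \<open>
  A finite simple undirected graph is a \<open>pair_graph\<close>: a finite loop-free digraph whose arc set is
  a symmetric set of ordered pairs, so that the edge \<open>uv\<close> is present as both \<open>(u, v)\<close> and
  \<open>(v, u)\<close>. The graph without vertices is allowed.
\<close>

section \<open>Linear rank-width\<close>

definition bit_scale :: "bit \<Rightarrow> ('a \<Rightarrow> bit) \<Rightarrow> 'a \<Rightarrow> bit" where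
  "bit_scale c f = (\<lambda>v. c * f v)"

interpretation bit_fun: vector_space bit_scale
  by unfold_locales
    (simp_all only: bit_scale_def fun_eq_iff plus_fun_apply distrib_left distrib_right mult.assoc mult_1 simp_thms)

text \<open>
  The row of the vertex \<open>u\<close> in the \<open>X \<times> (V(G) - X)\<close> adjacency matrix over the two-element field,
  extended by \<open>0\<close> outside the column set \<open>V(G) - X\<close> (which does not change the rank).
\<close>
definition cut_row :: "'a pair_pre_digraph \<Rightarrow> 'a set \<Rightarrow> 'a \<Rightarrow> 'a \<Rightarrow> bit" where
  "cut_row G X u = (\<lambda>v. if v \<in> pverts G - X \<and> (u, v) \<in> parcs G then 1 else 0)"

text \<open>The rank of a matrix is the dimension of its row space.\<close>
definition cutrank :: "'a pair_pre_digraph \<Rightarrow> 'a set \<Rightarrow> nat" where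
  "cutrank G X = bit_fun.dim (cut_row G X ` X)"

text \<open>
  A linear order of the vertices is a list enumerating each of them exactly once; its prefixes
  are \<open>set (take i vs)\<close> for \<open>i \<le> length vs\<close>.
\<close>
definition lrw :: "'a pair_pre_digraph \<Rightarrow> nat" where
  "lrw G = (MIN vs \<in> permutations_of_set (pverts G).
              MAX i \<in> {..length vs}. cutrank G (set (take i vs)))"

section \<open>Sequential cable plays\<close>

text \<open>As in the graph, a placed edge \<open>uv\<close> is recorded as the two pairs \<open>(u, v)\<close> and \<open>(v, u)\<close>.\<close>
record 'a config =
  born :: "'a set"
  live :: "'a set set"
  placed :: "('a \<times> 'a) set"

definition initial :: "'a config" where
  "initial = \<lparr>born = {}, live = {}, placed = {}\<rparr>"

datatype 'a move =
    Birth "'a set"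
  | Fold "'a set" "'a set"
  | Block "'a set" "'a set"
  | Clique "'a set"
  | Close "'a set"

definition inner_pairs :: "'a set \<Rightarrow> ('a \<times> 'a) set" where
  "inner_pairs X = {(u, v). u \<in> X \<and> v \<in> X \<and> u \<noteq> v}"

fun legal :: "'a pair_pre_digraph \<Rightarrow> 'a config \<Rightarrow> 'a move \<Rightarrow> bool" where
  "legal G c (Birth S) \<longleftrightarrow> S \<noteq> {} \<and> S \<subseteq> pverts G - born c"
| "legal G c (Fold X Y) \<longleftrightarrow> X \<in> live c \<and> Y \<in> live c \<and> X \<noteq> Y"
| "legal G c (Block X Y) \<longleftrightarrow> X \<in> live c \<and> Y \<in> live c \<and> X \<noteq> Y \<and>
     X \<times> Y \<subseteq> parcs G \<and> \<not> X \<times> Y \<subseteq> placed c"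
| "legal G c (Clique X) \<longleftrightarrow> X \<in> live c \<and>
     inner_pairs X \<subseteq> parcs G \<and> \<not> inner_pairs X \<subseteq> placed c"
| "legal G c (Close X) \<longleftrightarrow> X \<in> live c \<and> (\<forall>u v. u \<in> X \<and> (u, v) \<in> parcs G \<longrightarrow> (u, v) \<in> placed c)"

fun make_move :: "'a config \<Rightarrow> 'a move \<Rightarrow> 'a config" where
  "make_move c (Birth S) = c\<lparr>born := born c \<union> S, live := insert S (live c)\<rparr>"
| "make_move c (Fold X Y) = c\<lparr>live := insert (X \<union> Y) (live c - {X, Y})\<rparr>"
| "make_move c (Block X Y) = c\<lparr>placed := placed c \<union> X \<times> Y \<union> Y \<times> X\<rparr>"
| "make_move c (Clique X) = c\<lparr>placed := placed c \<union> inner_pairs X\<rparr>"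
| "make_move c (Close X) = c\<lparr>live := live c - {X}\<rparr>"

text \<open>
  The cost refers to the configuration before the move. The truncated subtractions are harmless:
  a legal \<open>Fold\<close> or \<open>Close\<close> needs at least one live cable.
\<close>
fun cost :: "'a config \<Rightarrow> 'a move \<Rightarrow> nat" where
  "cost c (Birth S) = 2 * card (live c) + 1"
| "cost c (Fold X Y) = 2 * card (live c) - 1"
| "cost c (Block X Y) = 2 * card (live c)"
| "cost c (Clique X) = 2 * card (live c)"
| "cost c (Close X) = 2 * card (live c) - 1"

fun legal_from :: "'a pair_pre_digraph \<Rightarrow> 'a config \<Rightarrow> 'a move list \<Rightarrow> bool" where
  "legal_from G c [] \<longleftrightarrow> True"
| "legal_from G c (m # ms) \<longleftrightarrow> legal G c m \<and> legal_from G (make_move c m) ms"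

fun costs_from :: "'a config \<Rightarrow> 'a move list \<Rightarrow> nat list" where
  "costs_from c [] = []"
| "costs_from c (m # ms) = cost c m # costs_from (make_move c m) ms"

definition is_play :: "'a pair_pre_digraph \<Rightarrow> 'a move list \<Rightarrow> bool" where
  "is_play G ms \<longleftrightarrow> legal_from G initial ms"

definition constructs :: "'a pair_pre_digraph \<Rightarrow> 'a move list \<Rightarrow> bool" where
  "constructs G ms \<longleftrightarrow> is_play G ms \<and>
     (let c = foldl make_move initial ms
      in born c = pverts G \<and> placed c = parcs G \<and> live c = {})"

text \<open>
  All costs of legal moves are positive; the inserted \<open>0\<close> only gives the empty play, hence the
  graph without vertices, the width \<open>0\<close>.
\<close>
definition play_width :: "'a move list \<Rightarrow> nat" where
  "play_width ms = Max (insert 0 (set (costs_from initial ms)))"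

definition lsfw :: "'a pair_pre_digraph \<Rightarrow> nat" where
  "lsfw G = (LEAST w. \<exists>ms. constructs G ms \<and> play_width ms = w)"

section \<open>The graph without vertices\<close>

lemma lrw_empty: "pverts G = {} \<Longrightarrow> lrw G = 0"
proof -
  assume "pverts G = {}"
  moreover have "bit_fun.dim ({} :: ('a \<Rightarrow> bit) set) = 0"
    using bit_fun.dim_eq_card_independent[OF bit_fun.independent_empty] by simp
  ultimately show ?thesis
    by (simp add: lrw_def cutrank_def)
qed

lemma lsfw_empty:
  assumes "pair_graph G" "pverts G = {}"
  shows "lsfw G = 0"
proof -
  interpret pair_graph G by fact
  have "parcs G = {}"
    using arc_fst_in_verts assms(2) by fastforce
  then have "constructs G []" and "play_width ([] :: 'a move list) = 0"
    using assms(2) by (simp_all add: constructs_def is_play_def initial_def play_width_def)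
  then show ?thesis
    unfolding lsfw_def by (intro Least_equality) auto
qed

end

theory Submission
  imports Defs
begin

text \<open>
  Lower bound: vertices of one live cable have the same incidences among the edges still to be
  placed, and closed vertices have none. Hence, ordering the vertices by birth, each prefix has
  cutrank at most the number of live cables right after the birth in progress. If the next move
  folds or closes, the configuration after it has placed no further edges and has one cable fewer,
  which makes up for the lower price of these moves.

  Upper bound: along an optimal linear order, keep as live cables the classes of vertices of the
  current prefix with the same nonzero row. These are distinct nonzero vectors of a space of
  dimension at most the linear rank-width \<open>k\<close>, so there are at most \<open>2 ^ k - 1\<close> of them, and at
  most \<open>2 ^ k\<close> cables are live after the birth of the next vertex.
\<close>

section \<open>Reachability at bounded cost\<close>

text \<open>Plays become paths of a relation with the width bound \<open>w\<close> built in, so that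
  rule induction runs backwards from the finished configuration.\<close>

definition cable_step :: "'a pair_pre_digraph \<Rightarrow> nat \<Rightarrow> 'a config \<Rightarrow> 'a config \<Rightarrow> bool" where
  "cable_step G w c d \<longleftrightarrow> (\<exists>m. legal G c m \<and> cost c m \<le> w \<and> d = make_move c m)"

abbreviation complete_config :: "'a pair_pre_digraph \<Rightarrow> 'a config" where
  "complete_config G \<equiv> \<lparr>born = pverts G, live = {}, placed = parcs G\<rparr>"

lemma cable_stepI: "legal G c m \<Longrightarrow> cost c m \<le> w \<Longrightarrow> cable_step G w c (make_move c m)"
  by (auto simp: cable_step_def)

lemma cable_steps_iff:
  "(cable_step G w)\<^sup>*\<^sup>* c d \<longleftrightarrow>
    (\<exists>ms. legal_from G c ms \<and> foldl make_move c ms = d \<and> (\<forall>x\<in>set (costs_from c ms). x \<le> w))"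
proof
  assume "(cable_step G w)\<^sup>*\<^sup>* c d"
  then show "\<exists>ms. legal_from G c ms \<and> foldl make_move c ms = d \<and> (\<forall>x\<in>set (costs_from c ms). x \<le> w)"
  proof (induction rule: converse_rtranclp_induct)
    case base
    show ?case by (rule exI[of _ "[]"]) simp
  next
    case (step c e)
    then obtain m ms where "legal G c m" "cost c m \<le> w" "e = make_move c m"
      "legal_from G e ms" "foldl make_move e ms = d" "\<forall>x\<in>set (costs_from e ms). x \<le> w"
      unfolding cable_step_def by blast
    then show ?case by (intro exI[of _ "m # ms"]) simp
  qed
next
  assume "\<exists>ms. legal_from G c ms \<and> foldl make_move c ms = d \<and> (\<forall>x\<in>set (costs_from c ms). x \<le> w)"
  then obtain ms where "legal_from G c ms" "foldl make_move c ms = d"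
    "\<forall>x\<in>set (costs_from c ms). x \<le> w"
    by blast
  then show "(cable_step G w)\<^sup>*\<^sup>* c d"
  proof (induction ms arbitrary: c)
    case (Cons m ms)
    then have "cable_step G w c (make_move c m)" "(cable_step G w)\<^sup>*\<^sup>* (make_move c m) d"
      by (auto intro: cable_stepI)
    then show ?case by (rule converse_rtranclp_into_rtranclp)
  qed simp
qed

text \<open>Bridge to the move lists in the definition of \<open>lsfw\<close>; both bounds are then
  proved about \<open>cable_step\<close> alone.\<close>

lemma ex_construction_iff:
  "(\<exists>ms. constructs G ms \<and> play_width ms \<le> w) \<longleftrightarrow>
    (cable_step G w)\<^sup>*\<^sup>* initial (complete_config G)"
proof -
  have "constructs G ms \<longleftrightarrow> legal_from G initial ms \<and> foldl make_move initial ms = complete_config G"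
    for ms
    by (auto simp: constructs_def is_play_def Let_def intro: config.equality)
  moreover have "play_width ms \<le> w \<longleftrightarrow> (\<forall>x\<in>set (costs_from initial ms). x \<le> w)" for ms :: "'a move list"
    by (simp add: play_width_def)
  ultimately show ?thesis
    unfolding cable_steps_iff by auto
qed

section \<open>Invariants of legal play\<close>

text \<open>Properties of the live cables that the record type does not enforce but that hold
  initially and survive every legal move.\<close>

definition wf_config :: "'a config \<Rightarrow> bool" where
  "wf_config c \<longleftrightarrow> finite (live c) \<and> pairwise disjnt (live c) \<and> {} \<notin> live c \<and> \<Union>(live c) \<subseteq> born c"

lemma wf_configD:
  assumes "wf_config c"
  shows "finite (live c)" "{} \<notin> live c" "\<Union>(live c) \<subseteq> born c"
    "\<And>X Y u. X \<in> live c \<Longrightarrow> Y \<in> live c \<Longrightarrow> u \<in> X \<Longrightarrow> u \<in> Y \<Longrightarrow> X = Y"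
  using assms by (auto simp: wf_config_def pairwise_def disjnt_iff)

lemma wf_initial: "wf_config initial"
  by (simp add: wf_config_def initial_def)

lemma wf_make_move:
  assumes "wf_config c" "legal G c m"
  shows "wf_config (make_move c m)"
proof (cases m)
  case (Birth S)
  then show ?thesis
    using assms unfolding wf_config_def pairwise_def disjnt_iff by (simp; blast)
next
  case (Fold X Y)
  then show ?thesis
    using assms unfolding wf_config_def pairwise_def disjnt_iff by (simp; blast)
next
  case (Close X)
  then show ?thesis
    using assms unfolding wf_config_def pairwise_def disjnt_iff by (simp; blast)
qed (use assms in \<open>simp_all add: wf_config_def\<close>)

section \<open>The lower bound\<close>

text \<open>A born vertex outside all live cables never returns: births use fresh vertices, and
  blocks and cliques touch live cables only. An edge at it that is still missing could therefore not
  be placed later, yet the play ends with all edges placed.\<close>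

lemma closed_vertex_placed:
  assumes "(cable_step G w)\<^sup>*\<^sup>* c (complete_config G)"
    and "u \<in> born c" "u \<notin> \<Union>(live c)" "(u, v) \<in> parcs G"
  shows "(u, v) \<in> placed c"
  using assms
proof (induction rule: converse_rtranclp_induct)
  case base
  then show ?case by simp
next
  case (step c d)
  obtain m where m: "legal G c m" "d = make_move c m"
    using step.hyps(1) by (auto simp: cable_step_def)
  show ?case
    using step.IH step.prems m by (cases m) (auto simp: inner_pairs_def)
qed

text \<open>The missing edge \<open>uv\<close> has to be placed later. Until then the cable of
  \<open>u\<close> is not closed and can only grow, so it keeps \<open>u'\<close>; the block or
  clique that places \<open>uv\<close> acts on whole cables and so forces \<open>u'v\<close> to be
  an edge too. The condition \<open>v \<noteq> u'\<close> rules out a loop.\<close>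

lemma cable_twins:
  assumes "(cable_step G w)\<^sup>*\<^sup>* c (complete_config G)" "sym (parcs G)"
    and "wf_config c" "X \<in> live c" "u \<in> X" "u' \<in> X" "v \<noteq> u'"
    and "(u, v) \<in> parcs G" "(u, v) \<notin> placed c"
  shows "(u', v) \<in> parcs G"
  using assms
proof (induction arbitrary: X rule: converse_rtranclp_induct)
  case base
  then show ?case by simp
next
  case (step c d)
  obtain m where m: "legal G c m" "d = make_move c m"
    using step.hyps(1) by (auto simp: cable_step_def)
  have wf: "wf_config d"
    using m step.prems by (simp add: wf_make_move)
  note IH = step.IH[OF step.prems(1) wf _ _ _ step.prems(6,7)]
  note eq = wf_configD(4)[OF step.prems(2)]
  show ?case
  proof (cases m)
    case (Birth S)
    then show ?thesis using step.prems m by (intro IH[of X]) auto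
  next
    case (Fold A B)
    then show ?thesis
      using step.prems m by (cases "X = A \<or> X = B"; intro IH[of "A \<union> B"] IH[of X]) auto
  next
    case (Block A B)
    show ?thesis
    proof (cases "(u, v) \<in> A \<times> B \<union> B \<times> A")
      case True
      \<comment> \<open>Live cables are disjoint, so the one of \<open>A\<close>, \<open>B\<close>
        that contains \<open>u\<close> is \<open>X\<close> itself.\<close>
      then have "(u', v) \<in> A \<times> B \<union> B \<times> A"
        using eq[of X A u] eq[of X B u] step.prems m Block by auto
      \<comment> \<open>Legality only asserts that \<open>A \<times> B\<close> consists of edges;
        symmetry supplies \<open>B \<times> A\<close>.\<close>
      then show ?thesis
        using m Block \<open>sym (parcs G)\<close> by (auto dest: symD)
    next
      case False
      then show ?thesis using step.prems m Block by (intro IH[of X]) auto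
    qed
  next
    case (Clique A)
    show ?thesis
    proof (cases "(u, v) \<in> inner_pairs A")
      case True
      then have "(u', v) \<in> inner_pairs A"
        using eq[of X A u] step.prems m Clique by (auto simp: inner_pairs_def)
      then show ?thesis
        using m Clique by auto
    next
      case False
      then show ?thesis using step.prems m Clique by (intro IH[of X]) auto
    qed
  next
    case (Close A)
    \<comment> \<open>Closing \<open>X\<close> would require \<open>uv\<close> to be placed
      already.\<close>
    then have "X \<noteq> A"
      using step.prems m by auto
    then show ?thesis using step.prems m Close by (intro IH[of X]) auto
  qed
qed

text \<open>Since no placed edge leaves \<open>P\<close>, the rows of \<open>P\<close> involve
  missing edges only. By \<open>cable_twins\<close> they agree on each cable, and they vanish on
  closed vertices, so one vector per live cable spans them. \<open>P\<close> may cut through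
  cables.\<close>

lemma cutrank_le_card_live:
  assumes "(cable_step G w)\<^sup>*\<^sup>* c (complete_config G)" "sym (parcs G)" "wf_config c"
    and P: "P \<subseteq> born c" and uncrossed: "placed c \<inter> P \<times> - P = {}"
  shows "cutrank G P \<le> card (live c)"
proof -
  \<comment> \<open>A cable that misses \<open>P\<close> contributes an arbitrary vector, which is
    harmless as only the size of \<open>W\<close> is used.\<close>
  define W where "W = (\<lambda>X. cut_row G P (SOME u. u \<in> X \<inter> P)) ` live c"
  have fin: "finite (live c)"
    using assms(3) by (rule wf_configD)
  have "cut_row G P u \<in> bit_fun.span W" if "u \<in> P" for u
  proof (cases "u \<in> \<Union>(live c)")
    case True
    then obtain X where X: "X \<in> live c" "u \<in> X" by blast
    define u' where "u' = (SOME u. u \<in> X \<inter> P)"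
    have u': "u' \<in> X" "u' \<in> P"
      using someI[of "\<lambda>u. u \<in> X \<inter> P" u] X that by (auto simp: u'_def)
    have "(u, v) \<in> parcs G \<longleftrightarrow> (u', v) \<in> parcs G" if "v \<notin> P" for v
      using cable_twins[OF assms(1-3) X(1), of _ _ v] X u' \<open>u \<in> P\<close> uncrossed that by blast
    then have "cut_row G P u = cut_row G P u'"
      by (auto simp: cut_row_def fun_eq_iff)
    then have "cut_row G P u \<in> W"
      using X by (auto simp: W_def u'_def)
    then show ?thesis by (rule bit_fun.span_base)
  next
    case False
    then have "(u, v) \<notin> parcs G" if "v \<notin> P" for v
      using closed_vertex_placed[OF assms(1), of u v] \<open>u \<in> P\<close> P uncrossed that by blast
    then have "cut_row G P u = 0"
      by (auto simp: cut_row_def fun_eq_iff)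
    then show ?thesis by (simp add: bit_fun.span_zero)
  qed
  then have "bit_fun.dim (cut_row G P ` P) \<le> card W"
    using fin by (intro bit_fun.dim_le_card) (auto simp: W_def)
  also have "\<dots> \<le> card (live c)"
    unfolding W_def using fin by (rule card_image_le)
  finally show ?thesis by (simp add: cutrank_def)
qed

text \<open>With \<open>l\<close> live cables, the next move costs at least \<open>2 * l\<close>
  unless it is a fold or a close, which costs \<open>2 * l - 1\<close>. After a fold or a close the
  cutrank is at most \<open>l - 1\<close>, and \<open>2 * (l - 1) \<le> 2 * l - 1\<close>.\<close>

lemma cutrank_le_width:
  assumes "(cable_step G w)\<^sup>*\<^sup>* c (complete_config G)" "sym (parcs G)" "wf_config c"
    and "P \<subseteq> born c" "placed c \<inter> P \<times> - P = {}"
  shows "2 * cutrank G P \<le> w"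
  using assms(1)
proof (cases rule: converse_rtranclpE)
  case base
  then show ?thesis
    using cutrank_le_card_live[OF assms] by simp
next
  case (step d)
  obtain m where m: "legal G c m" "cost c m \<le> w" "d = make_move c m"
    using step by (auto simp: cable_step_def)
  have fin: "finite (live c)"
    using assms(3) by (rule wf_configD)
  have le_c: "cutrank G P \<le> card (live c)"
    using assms by (rule cutrank_le_card_live)
  \<comment> \<open>Folds and closes change neither the born vertices nor the placed edges, so the
    hypotheses on \<open>P\<close> carry over to \<open>d\<close>.\<close>
  have le_d: "cutrank G P \<le> card (live d)" if "born d = born c" "placed d = placed c"
    using assms step(2) m that
    by (intro cutrank_le_card_live[of G w d P]) (simp_all add: wf_make_move)
  show ?thesis
  proof (cases m)
    case (Fold X Y)
    have "card (live d) \<le> Suc (card (live c - {X, Y}))"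
      using m Fold fin by (simp add: card_insert_if)
    also have "card {X, Y} = 2" "{X, Y} \<subseteq> live c"
      using m Fold by auto
    then have "Suc (card (live c - {X, Y})) = card (live c) - 1"
      using fin card_mono[of "live c" "{X, Y}"] by (simp add: card_Diff_subset)
    finally show ?thesis
      using le_d m Fold by simp
  next
    case (Close X)
    then have "card (live d) = card (live c) - 1"
      using m fin by simp
    then show ?thesis
      using le_d m Close by simp
  qed (use le_c m in auto)
qed

text \<open>Vertices are listed by birth, in any order within one birth. Restricting to
  \<open>0 < i\<close> makes the base case vacuous; the empty prefix is treated in
  \<open>lrw_le_half_width\<close>.\<close>

lemma ex_vertex_order:
  assumes "(cable_step G w)\<^sup>*\<^sup>* c (complete_config G)" "sym (parcs G)" "finite (pverts G)"
    and "wf_config c" "placed c \<subseteq> born c \<times> born c"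
  shows "\<exists>vs. distinct vs \<and> set vs = pverts G - born c \<and>
    (\<forall>i. 0 < i \<longrightarrow> i \<le> length vs \<longrightarrow> 2 * cutrank G (born c \<union> set (take i vs)) \<le> w)"
  using assms
proof (induction rule: converse_rtranclp_induct)
  case base
  then show ?case by (intro exI[of _ "[]"]) simp
next
  case (step c d)
  obtain m where m: "legal G c m" "d = make_move c m"
    using step.hyps(1) by (auto simp: cable_step_def)
  have wf: "wf_config d"
    using m step.prems by (simp add: wf_make_move)
  have placed: "placed d \<subseteq> born d \<times> born d"
    using m step.prems(4) wf_configD(3)[OF step.prems(3)]
    by (cases m) (auto simp: inner_pairs_def)
  obtain vs where vs: "distinct vs" "set vs = pverts G - born d"
    "\<And>i. 0 < i \<Longrightarrow> i \<le> length vs \<Longrightarrow> 2 * cutrank G (born d \<union> set (take i vs)) \<le> w"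
    using step.IH[OF step.prems(1,2) wf placed] by blast
  show ?case
  proof (cases "\<exists>S. m = Birth S")
    case False
    then have "born d = born c"
      using m by (cases m) auto
    then show ?thesis using vs by auto
  next
    case True
    then obtain S where S: "m = Birth S" by blast
    then have "finite S" and sub: "S \<subseteq> pverts G - born c"
      using m finite_subset[OF _ step.prems(2)] by auto
    then obtain ss where ss: "set ss = S" "distinct ss"
      using finite_distinct_list by blast
    have born: "born d = born c \<union> S"
      using m S by simp
    \<comment> \<open>A prefix that ends within \<open>ss\<close> is handled in the configuration
      \<open>d\<close> after the birth: its placed edges still lie among the previously born
      vertices, so none leaves the prefix. Longer prefixes contain all of \<open>S\<close> and come
      from the induction.\<close>
    have "2 * cutrank G (born c \<union> set (take i (ss @ vs))) \<le> w"
      if i: "0 < i" "i \<le> length (ss @ vs)" for i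
    proof (cases "i \<le> length ss")
      case True
      have "set (take i ss) \<subseteq> S"
        using ss set_take_subset by fast
      moreover have "placed d = placed c"
        using m S by simp
      ultimately show ?thesis
        using step.hyps step.prems wf born True
        by (intro cutrank_le_width[of G w d]) auto
    next
      case False
      then show ?thesis
        using vs(3)[of "i - length ss"] i born ss by (simp add: Un_assoc)
    qed
    moreover have "distinct (ss @ vs)" "set (ss @ vs) = pverts G - born c"
      using ss vs born sub by auto
    ultimately show ?thesis by blast
  qed
qed

section \<open>Linear rank-width as an attained minimum\<close>

lemma lrw_le:
  assumes "finite (pverts G)" "distinct vs" "set vs = pverts G"
    and "\<And>i. i \<le> length vs \<Longrightarrow> cutrank G (set (take i vs)) \<le> k"
  shows "lrw G \<le> k"
proof -
  have "lrw G \<le> (MAX i \<in> {..length vs}. cutrank G (set (take i vs)))"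
    unfolding lrw_def using assms(1-3)
    by (intro Min_le finite_imageI finite_permutations_of_set imageI permutations_of_setI)
  also have "\<dots> \<le> k"
    using assms(4) by simp
  finally show ?thesis .
qed

lemma lrw_obtain_order:
  assumes "finite (pverts G)"
  obtains vs where "distinct vs" "set vs = pverts G"
    "\<And>i. i \<le> length vs \<Longrightarrow> cutrank G (set (take i vs)) \<le> lrw G"
proof -
  have "lrw G \<in> (\<lambda>vs. MAX i \<in> {..length vs}. cutrank G (set (take i vs))) ` permutations_of_set (pverts G)"
    unfolding lrw_def using assms by (intro Min_in) auto
  then obtain vs where vs: "vs \<in> permutations_of_set (pverts G)"
    and lrw: "lrw G = (MAX i \<in> {..length vs}. cutrank G (set (take i vs)))"
    by blast
  show ?thesis
  proof
    show "distinct vs" "set vs = pverts G"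
      using vs by (auto simp: permutations_of_set_def)
    show "cutrank G (set (take i vs)) \<le> lrw G" if "i \<le> length vs" for i
      unfolding lrw using that by (intro Max_ge) auto
  qed
qed

lemma lrw_le_half_width:
  assumes "(cable_step G w)\<^sup>*\<^sup>* initial (complete_config G)" "sym (parcs G)" "finite (pverts G)"
  shows "2 * lrw G \<le> w"
proof -
  obtain vs where vs: "distinct vs" "set vs = pverts G"
    "\<And>i. 0 < i \<Longrightarrow> i \<le> length vs \<Longrightarrow> 2 * cutrank G (set (take i vs)) \<le> w"
    using ex_vertex_order[OF assms wf_initial] by (auto simp: initial_def)
  have "cutrank G (set (take i vs)) \<le> w div 2" if "i \<le> length vs" for i
  proof (cases i)
    case 0
    have "bit_fun.dim ({} :: ('a \<Rightarrow> bit) set) \<le> card ({} :: ('a \<Rightarrow> bit) set)"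
      by (rule bit_fun.dim_le_card) auto
    then show ?thesis using 0 by (simp add: cutrank_def)
  next
    case (Suc j)
    then show ?thesis using vs(3)[of i] that by simp
  qed
  then have "lrw G \<le> w div 2"
    using assms(3) vs by (intro lrw_le)
  then show ?thesis by simp
qed

section \<open>The upper bound\<close>

text \<open>The only scalars are 0 and 1, so a further generator \<open>b\<close> adds at most the
  translate of the span by \<open>b\<close> and at most doubles its size.\<close>

lemma card_span_bit_le:
  assumes "finite B"
  shows "finite (bit_fun.span B) \<and> card (bit_fun.span B) \<le> 2 ^ card B"
  using assms
proof induction
  case empty
  then show ?case by simp
next
  case (insert b B)
  have sub: "bit_fun.span (insert b B) \<subseteq> bit_fun.span B \<union> (+) b ` bit_fun.span B" (is "_ \<subseteq> ?U")
  proof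
    fix x
    assume "x \<in> bit_fun.span (insert b B)"
    then obtain k where k: "x - bit_scale k b \<in> bit_fun.span B"
      unfolding bit_fun.span_insert by blast
    show "x \<in> ?U"
    proof (cases k)
      case zero
      then show ?thesis using k by (simp add: bit_scale_def zero_fun_def[symmetric])
    next
      case one
      then have "x - b \<in> bit_fun.span B"
        using k bit_fun.scale_one by simp
      then show ?thesis by (force simp: image_iff)
    qed
  qed
  moreover have fin: "finite ?U"
    using insert.IH by simp
  moreover have "card ?U \<le> 2 ^ card B + 2 ^ card B"
    using insert.IH card_Un_le[of "bit_fun.span B" "(+) b ` bit_fun.span B"]
      card_image_le[of "bit_fun.span B" "(+) b"] by linarith
  ultimately have "card (bit_fun.span (insert b B)) \<le> 2 ^ card B + 2 ^ card B"
    using card_mono le_trans by blast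
  then show ?case
    using insert.hyps finite_subset[OF sub fin] by simp
qed

lemma card_nonzero_rows:
  assumes "finite P"
  shows "card (cut_row G P ` P - {0}) + 1 \<le> 2 ^ cutrank G P"
proof -
  let ?R = "cut_row G P ` P"
  obtain B where B: "B \<subseteq> ?R" "?R \<subseteq> bit_fun.span B" "card B = bit_fun.dim ?R"
    using bit_fun.basis_exists[of ?R] by metis
  have "finite B"
    using B(1) assms finite_subset by blast
  note span = card_span_bit_le[OF this]
  \<comment> \<open>The zero vector lies in the span without being a nonzero row; this saves the one
    cable that the next birth will occupy.\<close>
  have "card (?R - {0}) + 1 = card (insert 0 (?R - {0}))"
    using assms card.insert[of "?R - {0}" 0] by (simp del: insert_Diff_single)
  also have "\<dots> \<le> card (bit_fun.span B)"
    using B(2) span by (intro card_mono) (auto simp: bit_fun.span_zero)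
  finally show ?thesis
    using span B(3) by (simp add: cutrank_def)
qed

section \<open>Configurations whose cables consist of twins\<close>

text \<open>The state once \<open>P\<close> has been processed: its inner edges are placed, each
  cable lies inside a class of equal rows, and closed vertices have no neighbour outside
  \<open>P\<close>. Several cables may still share a class or have zero rows.\<close>

definition twin_config :: "'a pair_pre_digraph \<Rightarrow> 'a set \<Rightarrow> 'a config \<Rightarrow> bool" where
  "twin_config G P c \<longleftrightarrow> wf_config c \<and> born c = P \<and> placed c = parcs G \<inter> P \<times> P \<and>
    (\<forall>X\<in>live c. \<forall>u\<in>X. \<forall>u'\<in>X. cut_row G P u = cut_row G P u') \<and>
    (\<forall>u\<in>P - \<Union>(live c). cut_row G P u = 0)"

lemma twin_configI:
  assumes "wf_config c" "born c = P" "placed c = parcs G \<inter> P \<times> P"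
    and "\<And>X u u'. X \<in> live c \<Longrightarrow> u \<in> X \<Longrightarrow> u' \<in> X \<Longrightarrow> cut_row G P u = cut_row G P u'"
    and "\<And>u. u \<in> P \<Longrightarrow> u \<notin> \<Union>(live c) \<Longrightarrow> cut_row G P u = 0"
  shows "twin_config G P c"
  unfolding twin_config_def using assms by blast

text \<open>Here the live cables are exactly the classes of equal nonzero rows.\<close>

definition reduced_config :: "'a pair_pre_digraph \<Rightarrow> 'a set \<Rightarrow> 'a config \<Rightarrow> bool" where
  "reduced_config G P c \<longleftrightarrow> twin_config G P c \<and>
    (\<forall>u\<in>\<Union>(live c). cut_row G P u \<noteq> 0) \<and>
    (\<forall>X\<in>live c. \<forall>Y\<in>live c. X \<noteq> Y \<longrightarrow> (\<forall>u\<in>X. \<forall>v\<in>Y. cut_row G P u \<noteq> cut_row G P v))"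

lemma cut_row_eq_iff:
  "cut_row G P u = cut_row G P u' \<longleftrightarrow>
    (\<forall>v\<in>pverts G - P. (u, v) \<in> parcs G \<longleftrightarrow> (u', v) \<in> parcs G)"
  by (auto simp: cut_row_def fun_eq_iff split: if_splits)

lemma cut_row_eq_0_iff: "cut_row G P u = 0 \<longleftrightarrow> (\<forall>v\<in>pverts G - P. (u, v) \<notin> parcs G)"
  by (auto simp: cut_row_def fun_eq_iff split: if_splits)

text \<open>Cables with zero rows are closed and cables with equal rows are folded. Each such move
  lowers the number of live cables, so the process ends and the first cost bound covers all later
  moves.\<close>

lemma ex_reduced_config:
  assumes "twin_config G P c" "P \<subseteq> pverts G" "parcs G \<subseteq> pverts G \<times> pverts G"
    and "2 * card (live c) - 1 \<le> w"
  shows "\<exists>d. (cable_step G w)\<^sup>*\<^sup>* c d \<and> reduced_config G P d"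
  using assms
proof (induction "card (live c)" arbitrary: c rule: less_induct)
  case less
  have wf: "wf_config c" and born: "born c = P" and placed: "placed c = parcs G \<inter> P \<times> P"
    and twins: "\<And>X u u'. X \<in> live c \<Longrightarrow> u \<in> X \<Longrightarrow> u' \<in> X \<Longrightarrow> cut_row G P u = cut_row G P u'"
    and closed: "\<And>u. u \<in> P \<Longrightarrow> u \<notin> \<Union>(live c) \<Longrightarrow> cut_row G P u = 0"
    using less.prems(1) unfolding twin_config_def by blast+
  have fin: "finite (live c)"
    using wf by (rule wf_configD)
  \<comment> \<open>Any affordable move that keeps the twin property and lowers the number of live
    cables reduces the claim to the induction hypothesis.\<close>
  have move: ?case if m: "legal G c m" "cost c m \<le> w" "twin_config G P (make_move c m)"
    "card (live (make_move c m)) < card (live c)" for m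
  proof -
    have "\<exists>d. (cable_step G w)\<^sup>*\<^sup>* (make_move c m) d \<and> reduced_config G P d"
      using less.hyps[of "make_move c m"] m less.prems by simp
    then show ?thesis
      using cable_stepI[OF m(1,2)] by (blast intro: converse_rtranclp_into_rtranclp)
  qed
  consider (zero) X u where "X \<in> live c" "u \<in> X" "cut_row G P u = 0"
    | (equal) X Y u v where "X \<in> live c" "Y \<in> live c" "X \<noteq> Y" "u \<in> X" "v \<in> Y"
        "cut_row G P u = cut_row G P v"
    | (reduced) "reduced_config G P c"
    using less.prems(1) unfolding reduced_config_def by blast
  then show ?case
  proof cases
    case zero
    then have rows: "cut_row G P v = 0" if "v \<in> X" for v
      using twins that by metis
    have "X \<subseteq> P"
      using zero wf_configD(3)[OF wf] born by blast
    \<comment> \<open>A zero row leaves only edges inside \<open>P\<close>, all of which are placed;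
      this makes the close legal.\<close>
    have "(x, y) \<in> placed c" if "x \<in> X" "(x, y) \<in> parcs G" for x y
      using rows[OF that(1)] that \<open>X \<subseteq> P\<close> less.prems(3) unfolding placed cut_row_eq_0_iff by blast
    then have legal: "legal G c (Close X)"
      using zero(1) by simp
    moreover have "twin_config G P (make_move c (Close X))"
    proof (rule twin_configI)
      show "wf_config (make_move c (Close X))"
        using wf legal by (rule wf_make_move)
      show "cut_row G P x = 0" if "x \<in> P" "x \<notin> \<Union>(live (make_move c (Close X)))" for x
        using that closed[of x] rows[of x] by (cases "x \<in> X") auto
      show "cut_row G P x = cut_row G P y"
        if "Y \<in> live (make_move c (Close X))" "x \<in> Y" "y \<in> Y" for Y x y
        using that(1) by (intro twins[OF _ that(2,3)]) simp
    qed (use born placed in simp_all)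
    moreover have "card (live c - {X}) < card (live c)"
      using zero(1) fin by (intro psubset_card_mono) auto
    ultimately show ?thesis
      using less.prems(4) by (intro move[of "Close X"]) simp_all
  next
    case equal
    have rows: "cut_row G P x = cut_row G P y" if "x \<in> X \<union> Y" "y \<in> X \<union> Y" for x y
      using twins equal that by (metis UnE)
    have legal: "legal G c (Fold X Y)"
      using equal by simp
    have "twin_config G P (make_move c (Fold X Y))"
    proof (rule twin_configI)
      show "wf_config (make_move c (Fold X Y))"
        using wf legal by (rule wf_make_move)
      show "cut_row G P x = cut_row G P y"
        if "Z \<in> live (make_move c (Fold X Y))" "x \<in> Z" "y \<in> Z" for Z x y
        using that rows[of x y] twins[of Z x y] by (cases "Z = X \<union> Y") simp_all
      show "cut_row G P x = 0" if "x \<in> P" "x \<notin> \<Union>(live (make_move c (Fold X Y)))" for x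
        using that by (intro closed) auto
    qed (use born placed in simp_all)
    moreover have "card (insert (X \<union> Y) (live c - {X, Y})) < card (live c)"
    proof -
      have "card {X, Y} = 2"
        using equal(3) by simp
      moreover have "card {X, Y} \<le> card (live c)"
        using equal(1,2) fin by (intro card_mono) simp_all
      ultimately show ?thesis
        using equal(1-3) fin card_Diff_subset[of "{X, Y}" "live c"]
        by (auto simp: card_insert_if)
    qed
    ultimately show ?thesis
      using less.prems(4) legal by (intro move[of "Fold X Y"]) simp_all
  qed blast
qed

text \<open>Sending a cable to the common row of its vertices is injective into the nonzero
  rows.\<close>

lemma card_reduced_config:
  assumes "reduced_config G P c" "finite P"
  shows "card (live c) + 1 \<le> 2 ^ cutrank G P"
proof -
  let ?row = "\<lambda>X. cut_row G P (SOME u. u \<in> X)"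
  have wf: "wf_config c" and born: "born c = P"
    using assms(1) by (auto simp: reduced_config_def twin_config_def)
  have some: "(SOME u. u \<in> X) \<in> X" if "X \<in> live c" for X
    using that wf_configD(2)[OF wf] some_in_eq by metis
  have "inj_on ?row (live c)"
    using some assms(1) unfolding reduced_config_def inj_on_def by blast
  moreover have "?row ` live c \<subseteq> cut_row G P ` P - {0}"
  proof (rule image_subsetI)
    fix X assume "X \<in> live c"
    then have "(SOME u. u \<in> X) \<in> \<Union>(live c)"
      using some by blast
    then show "?row X \<in> cut_row G P ` P - {0}"
      using assms(1) wf_configD(3)[OF wf] born unfolding reduced_config_def by blast
  qed
  ultimately have "card (live c) \<le> card (cut_row G P ` P - {0})"
    using assms(2) by (intro card_inj_on_le) auto
  then show ?thesis
    using card_nonzero_rows[OF assms(2), of G] by simp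
qed

section \<open>Processing one more vertex\<close>

text \<open>One block per cable of \<open>A\<close> joins it to \<open>{v}\<close>; blocks leave the
  live cables unchanged, so each has the same cost.\<close>

lemma place_star:
  assumes "finite A" "wf_config c" "A \<subseteq> live c" "{v} \<in> live c" "{v} \<notin> A"
    and "\<And>X. X \<in> A \<Longrightarrow> {v} \<times> X \<subseteq> parcs G" "{v} \<times> \<Union>A \<inter> placed c = {}"
    and "2 * card (live c) \<le> w"
  shows "(cable_step G w)\<^sup>*\<^sup>* c (c\<lparr>placed := placed c \<union> {v} \<times> \<Union>A \<union> \<Union>A \<times> {v}\<rparr>)"
  using assms
proof (induction A rule: finite_induct)
  case empty
  then show ?case by simp
next
  case (insert X A)
  let ?c = "c\<lparr>placed := placed c \<union> {v} \<times> \<Union>A \<union> \<Union>A \<times> {v}\<rparr>"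
  have "(cable_step G w)\<^sup>*\<^sup>* c ?c"
    using insert.prems by (intro insert.IH) auto
  moreover have "cable_step G w ?c (make_move ?c (Block {v} X))"
  proof (rule cable_stepI)
    have X: "X \<in> live c" "A \<subseteq> live c"
      using insert.prems(2) by auto
    have "X \<noteq> {}"
      using X wf_configD(2)[OF insert.prems(1)] by blast
    then obtain x where x: "x \<in> X" by blast
    have "x \<notin> \<Union>A"
      using wf_configD(4)[OF insert.prems(1) X(1) _ x] X(2) insert.hyps(2) by blast
    moreover have "v \<notin> \<Union>A"
      using wf_configD(4)[OF insert.prems(1,3), of _ v] X(2) insert.prems(4) by blast
    \<comment> \<open>A block must place something new. The pair \<open>(v, x)\<close> is new
      because \<open>X\<close> is disjoint from the cables already joined.\<close>
    ultimately have "(v, x) \<notin> placed ?c"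
      using x insert.prems(6) by auto
    then show "legal G ?c (Block {v} X)"
      using x X(1) insert.prems(3,4) insert.prems(5)[of X] by auto
    show "cost ?c (Block {v} X) \<le> w"
      using insert.prems(7) by simp
  qed
  moreover have "make_move ?c (Block {v} X) =
      c\<lparr>placed := placed c \<union> {v} \<times> \<Union>(insert X A) \<union> \<Union>(insert X A) \<times> {v}\<rparr>"
    by (rule config.equality) auto
  ultimately show ?case
    using rtranclp.rtrancl_into_rtrancl by metis
qed

text \<open>With \<open>l\<close> live cables: bear \<open>v\<close> alone at cost
  \<open>2 * l + 1\<close>, join it to its neighbours in \<open>P\<close> by blocks at cost
  \<open>2 * (l + 1)\<close>, then fold and close at cost at most
  \<open>2 * (l + 1) - 1\<close>.\<close>

lemma reduced_config_insert:
  assumes "pair_graph G" "reduced_config G P c" "P \<subseteq> pverts G" "v \<in> pverts G - P"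
    and w: "2 * (card (live c) + 1) \<le> w"
  shows "\<exists>d. (cable_step G w)\<^sup>*\<^sup>* c d \<and> reduced_config G (insert v P) d"
proof -
  interpret pair_graph G by fact
  have "twin_config G P c"
    using assms(2) by (simp add: reduced_config_def)
  then have wf: "wf_config c" and born: "born c = P" and placed: "placed c = parcs G \<inter> P \<times> P"
    and twins: "\<And>X u u'. X \<in> live c \<Longrightarrow> u \<in> X \<Longrightarrow> u' \<in> X \<Longrightarrow> cut_row G P u = cut_row G P u'"
    and closed: "\<And>u. u \<in> P \<Longrightarrow> u \<notin> \<Union>(live c) \<Longrightarrow> cut_row G P u = 0"
    unfolding twin_config_def by blast+
  have sym: "(x, y) \<in> parcs G \<longleftrightarrow> (y, x) \<in> parcs G" for x y
    using arcs_symmetric by blast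
  have loop: "(x, x) \<notin> parcs G" for x
    using no_loops by fastforce
  have arcs: "parcs G \<subseteq> pverts G \<times> pverts G"
    using arc_fst_in_verts arc_snd_in_verts by fastforce
  have live_sub: "\<Union>(live c) \<subseteq> P"
    using wf_configD(3)[OF wf] born by simp
  define c1 where "c1 = make_move c (Birth {v})"
  have legal: "legal G c (Birth {v})"
    using assms(4) born by simp
  have c1: "born c1 = insert v P" "live c1 = insert {v} (live c)" "placed c1 = parcs G \<inter> P \<times> P"
    using born placed by (simp_all add: c1_def)
  have wf1: "wf_config c1"
    unfolding c1_def using wf legal by (rule wf_make_move)
  have new: "{v} \<notin> live c"
    using live_sub assms(4) by blast
  have card1: "card (live c1) = card (live c) + 1"
    using c1 new wf_configD(1)[OF wf] by simp
  define A where "A = {X \<in> live c. {v} \<times> X \<subseteq> parcs G}"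
  \<comment> \<open>Column \<open>v\<close> of the rows is constant on each cable and zero on closed
    vertices, so the neighbours of \<open>v\<close> in \<open>P\<close> fill whole cables.\<close>
  have A: "(v, u) \<in> parcs G \<longleftrightarrow> u \<in> \<Union>A" if u: "u \<in> P" for u
  proof
    assume vu: "(v, u) \<in> parcs G"
    then have "cut_row G P u \<noteq> 0"
      using assms(4) sym[of v u] by (auto simp: cut_row_eq_0_iff)
    then obtain X where X: "X \<in> live c" "u \<in> X"
      using closed[OF u] by blast
    have "(v, u') \<in> parcs G" if "u' \<in> X" for u'
      using twins[OF X that] vu assms(4) sym[of v] by (auto simp: cut_row_eq_iff)
    then show "u \<in> \<Union>A"
      using X by (auto simp: A_def)
  qed (auto simp: A_def)
  define c2 where "c2 = c1\<lparr>placed := placed c1 \<union> {v} \<times> \<Union>A \<union> \<Union>A \<times> {v}\<rparr>"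
  have c2: "born c2 = insert v P" "live c2 = insert {v} (live c)" "wf_config c2"
    using c1 wf1 by (auto simp: c2_def wf_config_def)
  have "cable_step G w c c1"
    unfolding c1_def using legal w by (intro cable_stepI) auto
  moreover have "(cable_step G w)\<^sup>*\<^sup>* c1 c2"
    unfolding c2_def
  proof (rule place_star[OF _ wf1])
    show "finite A"
      using wf_configD(1)[OF wf] by (simp add: A_def)
    show "{v} \<times> \<Union>A \<inter> placed c1 = {}"
      using c1 assms(4) by auto
  qed (use c1 new card1 w in \<open>auto simp: A_def\<close>)
  moreover have "\<exists>d. (cable_step G w)\<^sup>*\<^sup>* c2 d \<and> reduced_config G (insert v P) d"
  proof (rule ex_reduced_config)
    have "\<Union>A \<subseteq> P"
      using live_sub by (auto simp: A_def)
    then have "(x, y) \<in> placed c2 \<longleftrightarrow> (x, y) \<in> parcs G \<inter> insert v P \<times> insert v P" for x y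
      using A[of x] A[of y] sym[of x v] loop[of v] assms(4)
      by (auto simp add: c2_def c1(3) simp del: Union_iff)
    then have "placed c2 = parcs G \<inter> insert v P \<times> insert v P"
      by (intro set_eqI) (simp only: split_paired_all)
    \<comment> \<open>Passing from \<open>P\<close> to \<open>insert v P\<close> only deletes column
      \<open>v\<close> from old rows, so twins stay twins and zero rows stay zero.\<close>
    moreover have "cut_row G (insert v P) x = cut_row G (insert v P) y"
      if "X \<in> live c2" "x \<in> X" "y \<in> X" for X x y
    proof (cases "X = {v}")
      case False
      then show ?thesis
        using that c2(2) twins[of X x y] unfolding cut_row_eq_iff by blast
    qed (use that in simp)
    moreover have "cut_row G (insert v P) x = 0" if "x \<in> insert v P" "x \<notin> \<Union>(live c2)" for x
      using that c2(2) closed[of x] unfolding cut_row_eq_0_iff by blast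
    ultimately show "twin_config G (insert v P) c2"
      using c2 by (intro twin_configI)
    show "2 * card (live c2) - 1 \<le> w"
      using c1 c2 card1 w by simp
  qed (use assms arcs in auto)
  ultimately show ?thesis
    by (meson converse_rtranclp_into_rtranclp rtranclp_trans)
qed

lemma ex_construction_lrw:
  assumes "pair_graph G"
  shows "(cable_step G (2 ^ (lrw G + 1)))\<^sup>*\<^sup>* initial (complete_config G)"
proof -
  interpret pair_graph G by fact
  let ?R = "(cable_step G (2 ^ (lrw G + 1)))\<^sup>*\<^sup>*"
  obtain vs where vs: "distinct vs" "set vs = pverts G"
    "\<And>i. i \<le> length vs \<Longrightarrow> cutrank G (set (take i vs)) \<le> lrw G"
    using lrw_obtain_order[OF pair_finite_verts] by blast
  have "\<exists>c. ?R initial c \<and> reduced_config G (set (take i vs)) c" if "i \<le> length vs" for i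
    using that
  proof (induction i)
    case 0
    have "reduced_config G {} initial"
      using wf_initial by (simp add: reduced_config_def twin_config_def initial_def)
    then show ?case by auto
  next
    case (Suc i)
    let ?P = "set (take i vs)"
    obtain c where c: "?R initial c" "reduced_config G ?P c"
      using Suc by auto
    \<comment> \<open>At most \<open>2 ^ k - 1\<close> cables are live for \<open>k = lrw G\<close>,
      hence at most \<open>2 ^ k\<close> after the next birth, and doubling gives the width
      \<open>2 ^ (k + 1)\<close>.\<close>
    have "card (live c) + 1 \<le> 2 ^ cutrank G ?P"
      using c(2) by (intro card_reduced_config) simp_all
    also have "\<dots> \<le> 2 ^ lrw G"
      using vs(3)[of i] Suc.prems by (intro power_increasing) auto
    finally have "2 * (card (live c) + 1) \<le> 2 ^ (lrw G + 1)"
      by simp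
    moreover have "?P \<subseteq> pverts G"
      using vs(2) set_take_subset by fast
    moreover have "vs ! i \<in> pverts G - ?P"
      using vs(1) Suc.prems unfolding vs(2)[symmetric]
      by (auto simp: set_conv_nth nth_eq_iff_index_eq intro: Suc_le_lessD)
    ultimately obtain d where "?R c d" "reduced_config G (insert (vs ! i) ?P) d"
      using reduced_config_insert[OF assms c(2)] by blast
    moreover have "set (take (Suc i) vs) = insert (vs ! i) ?P"
      using Suc.prems by (simp add: take_Suc_conv_app_nth)
    ultimately show ?case
      using c(1) rtranclp_trans by metis
  qed
  from this[of "length vs"] obtain c where c: "?R initial c" "reduced_config G (pverts G) c"
    using vs(2) by auto
  have twin: "twin_config G (pverts G) c" and nonzero: "\<forall>u\<in>\<Union>(live c). cut_row G (pverts G) u \<noteq> 0"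
    using c(2) unfolding reduced_config_def by blast+
  then have wf: "wf_config c" and final: "born c = pverts G"
    "placed c = parcs G \<inter> pverts G \<times> pverts G"
    unfolding twin_config_def by blast+
  \<comment> \<open>Once all vertices are processed no columns remain; a reduced configuration has
    no cables with zero rows, so none is live.\<close>
  have "cut_row G (pverts G) u = 0" for u
    by (simp add: cut_row_eq_0_iff)
  then have "\<Union>(live c) = {}"
    using nonzero by auto
  then have "live c = {}"
    using wf_configD(2)[OF wf] by auto
  moreover have "parcs G \<inter> pverts G \<times> pverts G = parcs G"
    using arc_fst_in_verts arc_snd_in_verts by fastforce
  ultimately have "c = complete_config G"
    using final by (intro config.equality) simp_all
  then show ?thesis using c(1) by simp
qed

theorem corollary3p9:
  fixes G :: "'a pair_pre_digraph"
  assumes "pair_graph G"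
  shows "2 * lrw G \<le> lsfw G \<and> lsfw G \<le> 2 ^ (lrw G + 1) \<and>
         (lrw G \<le> 1 \<longrightarrow> lsfw G \<le> 4) \<and>
         (lrw G \<le> 2 \<longrightarrow> lsfw G \<le> 8)"
proof -
  interpret pair_graph G by fact
  have sym: "sym (parcs G)"
    using arcs_symmetric by (auto intro: symI)
  obtain ms where ms: "constructs G ms" "play_width ms \<le> 2 ^ (lrw G + 1)"
    using ex_construction_lrw[OF assms] unfolding ex_construction_iff[symmetric] by blast
  have "lsfw G \<le> play_width ms"
    unfolding lsfw_def using ms(1) by (intro Least_le) blast
  with ms(2) have upper: "lsfw G \<le> 2 ^ (lrw G + 1)"
    by simp
  \<comment> \<open>The play \<open>ms\<close> shows that some construction exists, so the minimum
    is attained and the lower bound applies with \<open>w = lsfw G\<close>.\<close>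
  have "\<exists>ms. constructs G ms \<and> play_width ms = lsfw G"
    unfolding lsfw_def by (rule LeastI[of _ "play_width ms"]) (use ms(1) in blast)
  then have "(cable_step G (lsfw G))\<^sup>*\<^sup>* initial (complete_config G)"
    unfolding ex_construction_iff[symmetric] by auto
  then have lower: "2 * lrw G \<le> lsfw G"
    using sym pair_finite_verts by (rule lrw_le_half_width)
  have "lsfw G \<le> 2 ^ (n + 1)" if "lrw G \<le> n" for n
    using upper that by (meson add_le_mono1 le_trans one_le_numeral power_increasing)
  from this[of 1] this[of 2] show ?thesis
    using lower upper by simp
qed

end
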